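(* Let $X$ be a Hilbert space and let $T\in LR(X)$ be Hermitian. Then: (i) $T$ is bounded from below (above) if and only if so is $\hat T_s$, with the same lower (upper) bound; (ii) $T$ is non-negative (non-positive) if and only if so is $\hat T_s$; (iii) $T$ is positive (negative) if and only if so is $\hat T_s$.
   Context: $LR(X)$ is the set of all linear subspaces of $X\times X$. For $T\in LR(X)$: $D(T)$ is its domain, $T(x)=\{y:(x,y)\in T\}$. A (single-valued) linear operator is identified with its graph. $T$ is Hermitian if $\langle y_2,x_1\rangle=\langle x_2,y_1\rangle$ for all $(x_1,y_1),(x_2,y_2)\in T$. Let $W\in LR(X)$ be Hermitian. $W$ is bounded from below (above) if there is $C\in\mathbf R$ with $\langle y,x\rangle\ge C\|x\|^2$ ($\langle y,x\rangle\le C\|x\|^2$) for all $(x,y)\in W$; such a $C$ is called a lower (upper) bound of $W$. $W$ is non-negative (non-positive) if $0$ is a lower (upper) bound of $W$. $W$ is positive (negative) if $\langle y,x\rangle>0$ ($\langle y,x\rangle<0$) for all $(x,y)\in W$ with $x\ne0$. $\hat T_s$ is the linear operator from $D(T)$ to $X$ given by $\hat T_s(x)=P_Ty$ for any $y\in T(x)$, where $P_T:X\to\overline{T(0)}^\perp$ is the orthogonal projection. (For $T$ Hermitian, $\hat T_s$ is Hermitian, so the notions above apply to it.) *)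

theory Defs
  imports "HOL-Analysis.Analysis" "HOL-Library.Complex_Order"
begin

text \<open>
  The library has real but no complex inner product spaces. The class below captures the two
  possible scalar fields \<open>\<real>\<close> and \<open>\<complex>\<close> at once: every \<open>z\<close> is a root of the real polynomial
  \<open>X\<^sup>2 - (z + conj z) X + z * conj z\<close>, so the field is \<open>\<real>\<close> or \<open>\<complex>\<close>. The order is the usual one on
  \<open>\<real>\<close> and that of \<open>Complex_Order\<close> on \<open>\<complex>\<close>; thus an inequality between a real number and a scalar
  includes the claim that the scalar is real.
\<close>

class rc_scalar = real_normed_field + order +
  fixes conj :: "'a \<Rightarrow> 'a"
  assumes conj_add: "conj (a + b) = conj a + conj b"
    and conj_mult: "conj (a * b) = conj a * conj b"
    and conj_conj: "conj (conj a) = a"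
    and add_conj: "\<exists>r. a + conj a = r *\<^sub>R 1"
    and mult_conj: "a * conj a = (norm a)\<^sup>2 *\<^sub>R 1"
    and le_iff_real_diff: "a \<le> b \<longleftrightarrow> (\<exists>r\<ge>0. b = a + r *\<^sub>R 1)"

instantiation real :: rc_scalar
begin
definition conj_real :: "real \<Rightarrow> real" where "conj_real r = r"
instance
proof
  show "a \<le> b \<longleftrightarrow> (\<exists>r\<ge>0. b = a + r *\<^sub>R 1)" for a b :: real
    by (auto intro: exI[of _ "b - a"])
qed (auto simp: conj_real_def power2_eq_square)
end

instantiation complex :: rc_scalar
begin
definition conj_complex :: "complex \<Rightarrow> complex" where "conj_complex z = cnj z"
instance
proof
  show "a \<le> b \<longleftrightarrow> (\<exists>r\<ge>0. b = a + r *\<^sub>R 1)" for a b :: complex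
    by (auto simp: less_eq_complex_def complex_eq_iff intro: exI[of _ "Re b - Re a"])
qed (auto simp: conj_complex_def complex_eq_iff cmod_power2 simp flip: power2_eq_square)
end

text \<open>Inner products are linear in the first argument. Completeness is part of the class \<open>banach\<close>.\<close>

locale hilbert_space = vector_space scale
  for scale :: "'k::rc_scalar \<Rightarrow> 'a::banach \<Rightarrow> 'a" +
  fixes ip :: "'a \<Rightarrow> 'a \<Rightarrow> 'k"
  assumes scale_of_real: "scale (of_real r) x = r *\<^sub>R x"
    and ip_add_left: "ip (x + y) z = ip x z + ip y z"
    and ip_scale_left: "ip (scale c x) z = c * ip x z"
    and ip_commute: "ip y x = conj (ip x y)"
    and ip_self: "ip x x = of_real ((norm x)\<^sup>2)"

lemma hilbert_space_real_inner:
  "hilbert_space scaleR (inner :: 'a::{real_inner, banach} \<Rightarrow> 'a \<Rightarrow> real)"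
  by unfold_locales
    (auto simp: algebra_simps inner_commute conj_real_def power2_norm_eq_inner inner_add_left)

lemma hilbert_space_complex: "hilbert_space (*) (\<lambda>x y :: complex. x * cnj y)"
  by unfold_locales
    (auto simp: algebra_simps conj_complex_def scaleR_conv_of_real simp flip: complex_norm_square)

definition LR :: "('k::rc_scalar \<Rightarrow> 'a::banach \<Rightarrow> 'a) \<Rightarrow> ('a \<times> 'a) set set" where
  "LR s = {T. module.subspace (module_prod.scale s s) T}"

definition rel_values :: "('a \<times> 'a) set \<Rightarrow> 'a \<Rightarrow> 'a set" where
  "rel_values T x = {y. (x, y) \<in> T}"

definition hermitian :: "('a \<Rightarrow> 'a \<Rightarrow> 'k) \<Rightarrow> ('a \<times> 'a) set \<Rightarrow> bool" where
  "hermitian ip T \<longleftrightarrow> (\<forall>(x1, y1) \<in> T. \<forall>(x2, y2) \<in> T. ip y2 x1 = ip x2 y1)"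

definition lower_bound :: "('a \<Rightarrow> 'a \<Rightarrow> 'k::rc_scalar) \<Rightarrow> ('a::banach \<times> 'a) set \<Rightarrow> real \<Rightarrow> bool" where
  "lower_bound ip W C \<longleftrightarrow> (\<forall>(x, y) \<in> W. ip y x \<ge> of_real (C * (norm x)\<^sup>2))"

definition upper_bound :: "('a \<Rightarrow> 'a \<Rightarrow> 'k::rc_scalar) \<Rightarrow> ('a::banach \<times> 'a) set \<Rightarrow> real \<Rightarrow> bool" where
  "upper_bound ip W C \<longleftrightarrow> (\<forall>(x, y) \<in> W. ip y x \<le> of_real (C * (norm x)\<^sup>2))"

definition bounded_from_below :: "('a \<Rightarrow> 'a \<Rightarrow> 'k::rc_scalar) \<Rightarrow> ('a::banach \<times> 'a) set \<Rightarrow> bool" where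
  "bounded_from_below ip W \<longleftrightarrow> (\<exists>C. lower_bound ip W C)"

definition bounded_from_above :: "('a \<Rightarrow> 'a \<Rightarrow> 'k::rc_scalar) \<Rightarrow> ('a::banach \<times> 'a) set \<Rightarrow> bool" where
  "bounded_from_above ip W \<longleftrightarrow> (\<exists>C. upper_bound ip W C)"

definition non_negative :: "('a \<Rightarrow> 'a \<Rightarrow> 'k::rc_scalar) \<Rightarrow> ('a::banach \<times> 'a) set \<Rightarrow> bool" where
  "non_negative ip W \<longleftrightarrow> lower_bound ip W 0"

definition non_positive :: "('a \<Rightarrow> 'a \<Rightarrow> 'k::rc_scalar) \<Rightarrow> ('a::banach \<times> 'a) set \<Rightarrow> bool" where
  "non_positive ip W \<longleftrightarrow> upper_bound ip W 0"

definition positive_rel :: "('a \<Rightarrow> 'a \<Rightarrow> 'k::rc_scalar) \<Rightarrow> ('a::banach \<times> 'a) set \<Rightarrow> bool" where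
  "positive_rel ip W \<longleftrightarrow> (\<forall>(x, y) \<in> W. x \<noteq> 0 \<longrightarrow> ip y x > 0)"

definition negative_rel :: "('a \<Rightarrow> 'a \<Rightarrow> 'k::rc_scalar) \<Rightarrow> ('a::banach \<times> 'a) set \<Rightarrow> bool" where
  "negative_rel ip W \<longleftrightarrow> (\<forall>(x, y) \<in> W. x \<noteq> 0 \<longrightarrow> ip y x < 0)"

definition orth_compl :: "('a \<Rightarrow> 'a \<Rightarrow> 'k::zero) \<Rightarrow> 'a set \<Rightarrow> 'a set" where
  "orth_compl ip S = {z. \<forall>w\<in>S. ip z w = 0}"

text \<open>Orthogonal projection onto \<open>M\<close>; meaningful for closed subspaces \<open>M\<close> of a Hilbert space.\<close>

definition orth_proj :: "('a \<Rightarrow> 'a \<Rightarrow> 'k::zero) \<Rightarrow> 'a::ab_group_add set \<Rightarrow> 'a \<Rightarrow> 'a" where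
  "orth_proj ip M y = (THE z. z \<in> M \<and> y - z \<in> orth_compl ip M)"

text \<open>
  The operator \<open>T\<^sub>s\<close> (with hat), given by its graph: it maps \<open>x\<close> in the domain of \<open>T\<close> to
  \<open>P\<^sub>T y\<close>, for any \<open>y \<in> T(x)\<close>.
\<close>

definition op_part :: "('a \<Rightarrow> 'a \<Rightarrow> 'k::zero) \<Rightarrow> ('a::banach \<times> 'a) set \<Rightarrow> ('a \<times> 'a) set" where
  "op_part ip T =
    {(x, orth_proj ip (orth_compl ip (closure (rel_values T 0))) y) |x y.
      x \<in> Domain T \<and> y \<in> rel_values T x}"

end

theory Submission
  imports Defs
begin

text \<open>
  Write \<open>M\<close> for the closure of \<open>T(0)\<close> and \<open>P\<close> for the orthogonal projection onto \<open>M\<^sup>\<bottom>\<close>. Comparing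
  \<open>(0, m)\<close> with \<open>(x, y)\<close> in the Hermitian condition gives \<open>\<langle>m, x\<rangle> = 0\<close>: the space \<open>T(0)\<close>, and by
  continuity also \<open>M\<close>, is orthogonal to the domain of \<open>T\<close>. Since \<open>y - P y\<close> lies in \<open>M\<close>, it follows
  that \<open>\<langle>P y, x\<rangle> = \<langle>y, x\<rangle>\<close> for all \<open>(x, y) \<in> T\<close> (\<open>ip_op_part_eq\<close>). Thus \<open>T\<close> and its operator part
  have the same pairs \<open>(x, \<langle>y, x\<rangle>)\<close>, and each of the properties in question is a property of
  these pairs alone.

  The analytic content is that \<open>P\<close> exists: a closed subspace has a point \<open>m\<close> nearest to \<open>y\<close>,
  and \<open>y - m\<close> is orthogonal to it. The link between distance and orthogonality is
  Birkhoff's criterion (\<open>ip_eq_0_iff_norm_le\<close>): \<open>u \<bottom> v\<close> iff no multiple of \<open>v\<close> added to \<open>u\<close>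
  makes it shorter. Being a condition on norms, it also shows that orthogonality is preserved by
  limits, so that the Cauchy--Schwarz inequality is avoided.
\<close>

section \<open>Nearest points\<close>

text \<open>
  If two points of \<open>S\<close> are almost as close to \<open>y\<close> as possible, then so is their midpoint, and the
  parallelogram law forces them to be close to each other. Hence the sets of almost nearest
  points shrink to a single point.
\<close>

lemma nearest_point_exists:
  fixes S :: "'a::banach set"
  assumes parallelogram: "\<And>u v :: 'a. (norm (u + v))\<^sup>2 + (norm (u - v))\<^sup>2 = 2 * (norm u)\<^sup>2 + 2 * (norm v)\<^sup>2"
    and "closed S" "convex S" "S \<noteq> {}"
  shows "\<exists>m\<in>S. \<forall>w\<in>S. norm (y - m) \<le> norm (y - w)"
proof -
  define d where "d = (INF w\<in>S. (norm (y - w))\<^sup>2)"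
  define A where "A n = {w \<in> S. (norm (y - w))\<^sup>2 \<le> d + inverse (real (Suc n))}" for n
  have bdd: "bdd_below ((\<lambda>w. (norm (y - w))\<^sup>2) ` S)"
    by (rule bdd_belowI[of _ 0]) auto
  have d_le: "d \<le> (norm (y - w))\<^sup>2" if "w \<in> S" for w
    unfolding d_def using bdd that by (rule cINF_lower)
  have "\<exists>a. \<forall>n. a \<in> A n"
  proof (rule decreasing_closed_nest)
    have "closed (S \<inter> {w. (norm (y - w))\<^sup>2 \<le> d + inverse (real (Suc n))})" for n
      using \<open>closed S\<close> by (intro closed_Int closed_Collect_le continuous_intros)
    then show "closed (A n)" for n
      by (simp add: A_def Int_def)
    show "A n \<noteq> {}" for n
    proof -
      have "d < d + inverse (real (Suc n))" by simp
      then obtain w where "w \<in> S" "(norm (y - w))\<^sup>2 < d + inverse (real (Suc n))"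
        unfolding d_def using cINF_less_iff[OF \<open>S \<noteq> {}\<close> bdd] by blast
      then show ?thesis by (auto simp: A_def intro: less_imp_le)
    qed
    show "A n \<subseteq> A m" if "m \<le> n" for m n
    proof -
      have "inverse (real (Suc n)) \<le> inverse (real (Suc m))"
        using that by (intro le_imp_inverse_le) auto
      then show ?thesis by (auto simp: A_def simp del: of_nat_Suc intro: order_trans)
    qed
    show "\<exists>n. \<forall>u\<in>A n. \<forall>v\<in>A n. dist u v < e" if "e > 0" for e :: real
    proof -
      obtain n where n: "inverse (real (Suc n)) < e\<^sup>2 / 4"
        using reals_Archimedean[of "e\<^sup>2 / 4"] \<open>e > 0\<close> by auto
      have "dist u v < e" if "u \<in> A n" "v \<in> A n" for u v
      proof -
        define w where "w = (1/2) *\<^sub>R u + (1/2) *\<^sub>R v"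
        have "w \<in> S"
          using \<open>convex S\<close> that unfolding convex_def w_def A_def by auto
        have "(y - u) + (y - v) = 2 *\<^sub>R (y - w)"
          by (simp add: w_def algebra_simps scaleR_2)
        then have "norm ((y - u) + (y - v)) = 2 * norm (y - w)" by simp
        then have "4 * (norm (y - w))\<^sup>2 + (norm (u - v))\<^sup>2 = 2 * (norm (y - u))\<^sup>2 + 2 * (norm (y - v))\<^sup>2"
          using parallelogram[of "y - u" "y - v"] by (simp add: norm_minus_commute power_mult_distrib)
        then have "(dist u v)\<^sup>2 < e\<^sup>2"
          using d_le[OF \<open>w \<in> S\<close>] that n by (auto simp: A_def dist_norm)
        then show ?thesis using \<open>e > 0\<close> by (simp add: power_less_imp_less_base)
      qed
      then show ?thesis by blast
    qed
  qed blast
  then obtain m where m: "\<And>n. m \<in> A n" by blast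
  have "(norm (y - m))\<^sup>2 \<le> d"
  proof (rule field_le_epsilon)
    fix e :: real assume "e > 0"
    then obtain n where "inverse (real (Suc n)) < e" using reals_Archimedean by blast
    then show "(norm (y - m))\<^sup>2 \<le> d + e" using m[of n] by (auto simp: A_def)
  qed
  then have "norm (y - m) \<le> norm (y - w)" if "w \<in> S" for w
    using d_le[OF that] order_trans by (blast intro: power2_le_imp_le[OF _ norm_ge_zero])
  then show ?thesis using m by (auto simp: A_def)
qed

section \<open>Orthogonality\<close>

context hilbert_space
begin

lemma conj_0: "conj 0 = (0::'k)"
  using conj_add[of "0::'k" 0] by simp

lemma ip_0_left: "ip 0 z = 0"
  using ip_add_left[of 0 0 z] by simp

lemma ip_diff_left: "ip (x - y) z = ip x z - ip y z"
  using ip_add_left[of "x - y" y z] by simp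

lemma ip_eq_0_commute: "ip x y = 0 \<longleftrightarrow> ip y x = 0"
  by (metis conj_0 ip_commute)

lemma ip_add_right: "ip z (x + y) = ip z x + ip z y"
  by (metis ip_add_left ip_commute conj_add)

lemma ip_diff_right: "ip z (x - y) = ip z x - ip z y"
  using ip_add_right[of z "x - y" y] by simp

lemma ip_self_eq_0: "ip x x = 0 \<longleftrightarrow> x = 0"
  by (simp add: ip_self)

lemma parallelogram_law:
  fixes u v :: 'a
  shows "(norm (u + v))\<^sup>2 + (norm (u - v))\<^sup>2 = 2 * (norm u)\<^sup>2 + 2 * (norm v)\<^sup>2"
proof -
  have "ip (u + v) (u + v) + ip (u - v) (u - v) = 2 * ip u u + 2 * ip v v"
    by (simp add: ip_add_left ip_add_right ip_diff_left ip_diff_right algebra_simps)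
  then have "(of_real ((norm (u + v))\<^sup>2 + (norm (u - v))\<^sup>2) :: 'k) = of_real (2 * (norm u)\<^sup>2 + 2 * (norm v)\<^sup>2)"
    by (simp add: ip_self)
  then show ?thesis by (simp only: of_real_eq_iff)
qed

lemma pythagoras:
  assumes "ip u v = 0"
  shows "(norm (u + v))\<^sup>2 = (norm u)\<^sup>2 + (norm v)\<^sup>2"
proof -
  have "ip (u + v) (u + v) = ip u u + ip v v"
    using assms ip_eq_0_commute[of u v] by (simp add: ip_add_left ip_add_right)
  then have "(of_real ((norm (u + v))\<^sup>2) :: 'k) = of_real ((norm u)\<^sup>2 + (norm v)\<^sup>2)"
    by (simp add: ip_self)
  then show ?thesis by (simp only: of_real_eq_iff)
qed

lemma ip_eq_0_iff_norm_le: "ip u v = 0 \<longleftrightarrow> (\<forall>c. norm u \<le> norm (u + scale c v))"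
proof
  assume "ip u v = 0"
  then have "ip u (scale c v) = 0" for c
    by (simp add: ip_eq_0_commute[of u] ip_scale_left)
  then have "(norm u)\<^sup>2 \<le> (norm (u + scale c v))\<^sup>2" for c
    by (simp add: pythagoras)
  then show "\<forall>c. norm u \<le> norm (u + scale c v)"
    by (blast intro: power2_le_imp_le[OF _ norm_ge_zero])
next
  assume *: "\<forall>c. norm u \<le> norm (u + scale c v)"
  show "ip u v = 0"
  proof (cases "v = 0")
    case True
    then show ?thesis by (simp add: ip_eq_0_commute[of u] ip_0_left)
  next
    case False
    \<comment> \<open>Split \<open>u\<close> into \<open>u + c v\<close>, orthogonal to \<open>v\<close>, and \<open>- c v\<close>; as the former cannot be shorter
      than \<open>u\<close>, the latter vanishes.\<close>
    define c where "c = - ip u v / ip v v"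
    have vv: "ip v v \<noteq> 0" using False by (simp add: ip_self_eq_0)
    have "ip (u + scale c v) v = 0"
      using vv by (simp add: c_def ip_add_left ip_scale_left del: scale_minus_left)
    then have "ip (u + scale c v) (scale (- c) v) = 0"
      by (simp add: ip_eq_0_commute[of _ "scale _ _"] ip_eq_0_commute[of v] ip_scale_left del: scale_minus_left)
    from pythagoras[OF this]
    have "(norm u)\<^sup>2 = (norm (u + scale c v))\<^sup>2 + (norm (scale c v))\<^sup>2" by simp
    moreover have "(norm u)\<^sup>2 \<le> (norm (u + scale c v))\<^sup>2"
      using * by (intro power_mono) auto
    ultimately have "scale c v = 0" by simp
    then show ?thesis using False vv by (simp add: c_def)
  qed
qed

lemma closed_orthogonal: "closed {w. ip w u = 0}"
  unfolding ip_eq_0_iff_norm_le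
  by (intro closed_Collect_all closed_Collect_le continuous_intros)

lemma ip_eq_0_on_closure:
  assumes "\<And>w. w \<in> N \<Longrightarrow> ip w u = 0" "w \<in> closure N"
  shows "ip w u = 0"
  using closure_minimal[OF _ closed_orthogonal[of u], of N] assms by auto

lemma subspace_imp_convex:
  assumes "subspace N"
  shows "convex N"
  unfolding convex_def
  using assms by (metis scale_of_real subspace_add subspace_scale)

section \<open>Orthogonal projection and the operator part\<close>

text \<open>
  Minimality of \<open>y - m\<close> for the nearest point \<open>m\<close> is Birkhoff's criterion against vectors of \<open>N\<close>,
  because translation by such a vector maps the closure of \<open>N\<close> to itself.
\<close>

lemma orthogonal_decomposition:
  assumes "subspace N"
  obtains m where "m \<in> closure N" "y - m \<in> orth_compl ip (closure N)"
proof -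
  have "closure N \<noteq> {}" using subspace_0[OF assms] by auto
  then obtain m where m: "m \<in> closure N" and min: "\<And>w. w \<in> closure N \<Longrightarrow> norm (y - m) \<le> norm (y - w)"
    using nearest_point_exists[OF parallelogram_law closed_closure convex_closure[OF subspace_imp_convex[OF assms]]]
    by blast
  have "ip w (y - m) = 0" if "w \<in> N" for w
  proof -
    have "m - scale c w \<in> closure N" for c
    proof -
      have "(\<lambda>v. v - scale c w) ` closure N \<subseteq> closure N"
        using assms that closure_subset[of N]
        by (intro image_closure_subset continuous_intros)
          (auto intro: subspace_diff subspace_scale)
      then show ?thesis using m by blast
    qed
    from min[OF this] have "norm (y - m) \<le> norm ((y - m) + scale c w)" for c
      by (simp add: algebra_simps)
    then show ?thesis
      by (simp only: ip_eq_0_commute[of w] ip_eq_0_iff_norm_le[of "y - m"]) blast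
  qed
  then have "y - m \<in> orth_compl ip (closure N)"
    unfolding orth_compl_def using ip_eq_0_on_closure ip_eq_0_commute by blast
  with m that show thesis by blast
qed

text \<open>
  The component \<open>y - m\<close> satisfies the description of the projection onto the orthogonal complement,
  as \<open>m\<close> lies in the double complement; uniqueness holds because a subspace meets its orthogonal
  complement in \<open>0\<close> only.
\<close>

lemma minus_orth_proj_in_closure:
  assumes "subspace N"
  shows "y - orth_proj ip (orth_compl ip (closure N)) y \<in> closure N"
proof -
  let ?M = "orth_compl ip (closure N)"
  obtain m where m: "m \<in> closure N" "y - m \<in> ?M"
    using orthogonal_decomposition[OF assms] .
  have "orth_proj ip ?M y = y - m"
    unfolding orth_proj_def
  proof (rule the_equality)
    show "y - m \<in> ?M \<and> y - (y - m) \<in> orth_compl ip ?M"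
      using m ip_eq_0_commute by (auto simp: orth_compl_def)
    show "z = y - m" if "z \<in> ?M \<and> y - z \<in> orth_compl ip ?M" for z
    proof -
      have "z - (y - m) \<in> ?M"
        using that m by (simp add: orth_compl_def ip_diff_left)
      then have "ip (y - z) (z - (y - m)) = 0" "ip m (z - (y - m)) = 0"
        using that m ip_eq_0_commute unfolding orth_compl_def by blast+
      then have "ip (m - (y - z)) (z - (y - m)) = 0"
        by (simp only: ip_diff_left[of m "y - z"]) simp
      moreover have "m - (y - z) = z - (y - m)" by simp
      ultimately show ?thesis by (simp add: ip_self_eq_0)
    qed
  qed
  with m show ?thesis by simp
qed

lemma subspace_rel_values_0:
  assumes "T \<in> LR scale"
  shows "subspace (rel_values T 0)"
proof -
  interpret P: module_prod scale scale ..
  have T: "P.p.subspace T" using assms by (simp add: LR_def)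
  show ?thesis
  proof (rule subspaceI)
    show "0 \<in> rel_values T 0"
      using P.p.subspace_0[OF T] by (simp add: rel_values_def zero_prod_def)
    show "x + y \<in> rel_values T 0" if "x \<in> rel_values T 0" "y \<in> rel_values T 0" for x y
      using P.p.subspace_add[OF T, of "(0, x)" "(0, y)"] that by (simp add: rel_values_def)
    show "scale c x \<in> rel_values T 0" if "x \<in> rel_values T 0" for c x
      using P.p.subspace_scale[OF T, of "(0, x)" c] that by (simp add: rel_values_def P.scale_def)
  qed
qed

lemma ip_op_part_eq:
  assumes "T \<in> LR scale" "hermitian ip T" "(x, y) \<in> T"
  shows "ip (orth_proj ip (orth_compl ip (closure (rel_values T 0))) y) x = ip y x"
proof -
  let ?P = "orth_proj ip (orth_compl ip (closure (rel_values T 0)))"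
  have "ip w x = 0" if "w \<in> rel_values T 0" for w
  proof -
    have "(0, w) \<in> T" using that by (simp add: rel_values_def)
    then have "ip w x = ip 0 y" using assms unfolding hermitian_def by blast
    then show ?thesis by (simp add: ip_0_left)
  qed
  then have "ip (y - ?P y) x = 0"
    using ip_eq_0_on_closure minus_orth_proj_in_closure[OF subspace_rel_values_0[OF assms(1)]] by blast
  then show ?thesis by (simp add: ip_diff_left)
qed

text \<open>The principle by which all the properties in question pass between \<open>T\<close> and its operator part.\<close>

lemma ball_op_part_iff:
  assumes "T \<in> LR scale" "hermitian ip T"
  shows "(\<forall>(x, y) \<in> op_part ip T. Q x (ip y x)) \<longleftrightarrow> (\<forall>(x, y) \<in> T. Q x (ip y x))"
proof -
  have "op_part ip T =
      (\<lambda>(x, y). (x, orth_proj ip (orth_compl ip (closure (rel_values T 0))) y)) ` T"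
    by (force simp: op_part_def rel_values_def)
  then show ?thesis using ip_op_part_eq[OF assms] by fastforce
qed

end

theorem theorem3p3:
  fixes scale :: "'k::rc_scalar \<Rightarrow> 'a::banach \<Rightarrow> 'a"
    and ip :: "'a \<Rightarrow> 'a \<Rightarrow> 'k"
    and T :: "('a \<times> 'a) set"
  assumes "hilbert_space scale ip"
    and "T \<in> LR scale"
    and "hermitian ip T"
  shows "((bounded_from_below ip T \<longleftrightarrow> bounded_from_below ip (op_part ip T)) \<and>
          (\<forall>C. lower_bound ip T C \<longleftrightarrow> lower_bound ip (op_part ip T) C) \<and>
          (bounded_from_above ip T \<longleftrightarrow> bounded_from_above ip (op_part ip T)) \<and>
          (\<forall>C. upper_bound ip T C \<longleftrightarrow> upper_bound ip (op_part ip T) C)) \<and>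
         ((non_negative ip T \<longleftrightarrow> non_negative ip (op_part ip T)) \<and>
          (non_positive ip T \<longleftrightarrow> non_positive ip (op_part ip T))) \<and>
         ((positive_rel ip T \<longleftrightarrow> positive_rel ip (op_part ip T)) \<and>
          (negative_rel ip T \<longleftrightarrow> negative_rel ip (op_part ip T)))"
proof -
  note transfer = hilbert_space.ball_op_part_iff[OF assms]
  have lower: "lower_bound ip (op_part ip T) C \<longleftrightarrow> lower_bound ip T C" for C
    unfolding lower_bound_def by (rule transfer)
  have upper: "upper_bound ip (op_part ip T) C \<longleftrightarrow> upper_bound ip T C" for C
    unfolding upper_bound_def by (rule transfer)
  have pos: "positive_rel ip (op_part ip T) \<longleftrightarrow> positive_rel ip T"
    unfolding positive_rel_def by (rule transfer)
  have neg: "negative_rel ip (op_part ip T) \<longleftrightarrow> negative_rel ip T"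
    unfolding negative_rel_def by (rule transfer)
  show ?thesis
    by (simp add: bounded_from_below_def bounded_from_above_def non_negative_def non_positive_def
        lower upper pos neg)
qed

end
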